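(* As formal power series in $t$ and $z$ with coefficients in $\mathbb{Z}[p]$, $$\sum_{n\ge0}\frac{\mathcal F_n(p,t)}{(1-t)^{n+1}}\,z^n=\sum_{m\ge0}t^m\,\frac{(1+pz)^m}{(1-pz)^{m+1}(1-z^2)^{m(m+1)}},$$ where $$\mathcal F_n(p,t)=\sum_{\pi\in\mathcal I_n^B}p^{\operatorname{fix}_B(\pi)}\,t^{\operatorname{des}^B(\pi)}.$$
   Context: For $n\ge1$, the hyperoctahedral group $\mathfrak B_n$ is the group of signed permutations: words $\pi=\pi_1\cdots\pi_n$ of nonzero integers such that $|\pi_1|,\dots,|\pi_n|$ is a permutation of $[n]=\{1,\dots,n\}$, identified with bijections of $\{\pm1,\dots,\pm n\}$ via $\pi(i)=\pi_i$, $\pi(-i)=-\pi(i)$. $\mathcal I_n^B$ is the set of involutions of $\mathfrak B_n$, i.e. elements with $\pi^2=\mathrm{id}$ (including the identity). For $n=0$, $\mathcal I_0^B$ consists of the empty signed permutation, so $\mathcal F_0(p,t)=1$. With $\pi_0=0$ and the usual order on $\mathbb Z$ (natural order), $\operatorname{des}^B(\pi)=\#\{i\in\{0,1,\dots,n-1\}:\pi_i>\pi_{i+1}\}$. The number of fixed positions is $\operatorname{fix}_B(\pi)=\#\{i\in[n]:|\pi(i)|=i\}$ (both $\pi(i)=i$ and $\pi(i)=-i$ count). *)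

theory Defs
  imports "HOL-Computational_Algebra.Computational_Algebra" "HOL-Combinatorics.Permutations"
begin

text \<open>
  Signed permutations are taken as odd bijections of \<open>{\<plusminus>1, \<dots>, \<plusminus>n}\<close>, extended by the identity to all
  integers. In particular \<open>\<pi> 0 = 0\<close>, which is the convention \<open>\<pi>\<^sub>0 = 0\<close> used for descents.
\<close>

definition signed_perms :: "nat \<Rightarrow> (int \<Rightarrow> int) set" where
  "signed_perms n = {\<pi>. \<pi> permutes ({- int n..int n} - {0}) \<and> (\<forall>i. \<pi> (- i) = - \<pi> i)}"

definition signed_involutions :: "nat \<Rightarrow> (int \<Rightarrow> int) set" where
  "signed_involutions n = {\<pi> \<in> signed_perms n. \<pi> \<circ> \<pi> = id}"

definition des_B :: "nat \<Rightarrow> (int \<Rightarrow> int) \<Rightarrow> nat" where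
  "des_B n \<pi> = card {i \<in> {0..<int n}. \<pi> i > \<pi> (i + 1)}"

definition fix_B :: "nat \<Rightarrow> (int \<Rightarrow> int) \<Rightarrow> nat" where
  "fix_B n \<pi> = card {i \<in> {1..int n}. \<bar>\<pi> i\<bar> = i}"

text \<open>The polynomial \<open>\<F>\<^sub>n(p,t)\<close>, evaluated at elements of an arbitrary commutative ring.\<close>

definition inv_poly :: "nat \<Rightarrow> 'a::comm_ring_1 \<Rightarrow> 'a \<Rightarrow> 'a" where
  "inv_poly n p t = (\<Sum>\<pi>\<in>signed_involutions n. p ^ fix_B n \<pi> * t ^ des_B n \<pi>)"

text \<open>
  Reciprocal of a power series with constant term \<open>1\<close>. The library's \<open>inverse\<close> on power series needs
  an inverse operation on the coefficients, which \<open>\<int>[p]\<close> and \<open>\<int>[p][[t]]\<close> lack.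
\<close>

definition fps_recip :: "'a::comm_ring_1 fps \<Rightarrow> 'a fps" where
  "fps_recip f = fps_right_inverse f 1"

lemma fps_recip_right: "fps_nth f 0 = 1 \<Longrightarrow> f * fps_recip f = 1"
  by (simp add: fps_recip_def fps_right_inverse)

text \<open>
  Convergence of a series of bivariate power series: every coefficient of the partial sums is
  eventually constant. The library's topology on \<open>'a fps fps\<close> is unsuitable, because it treats the
  coefficients (here power series in \<open>t\<close>) as discrete, so that \<open>\<Sum>m. t\<^sup>m\<close> would diverge.
\<close>

definition fps2_sums :: "(nat \<Rightarrow> 'a::comm_ring_1 fps fps) \<Rightarrow> 'a fps fps \<Rightarrow> bool" where
  "fps2_sums f S \<longleftrightarrow>
     (\<forall>i j. \<forall>\<^sub>F N in sequentially. fps_nth (fps_nth (\<Sum>m<N. f m) i) j = fps_nth (fps_nth S i) j)"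

lemma fps2_sums_unique:
  assumes "fps2_sums f S" "fps2_sums f S'"
  shows "S = S'"
proof (intro fps_ext)
  fix i j
  from assms have "\<forall>\<^sub>F N in sequentially. fps_nth (fps_nth (\<Sum>m<N. f m) i) j = fps_nth (fps_nth S i) j"
    and "\<forall>\<^sub>F N in sequentially. fps_nth (fps_nth (\<Sum>m<N. f m) i) j = fps_nth (fps_nth S' i) j"
    unfolding fps2_sums_def by blast+
  then have "\<forall>\<^sub>F N in sequentially. fps_nth (fps_nth S i) j = fps_nth (fps_nth S' i) j"
    by eventually_elim simp
  then show "fps_nth (fps_nth S i) j = fps_nth (fps_nth S' i) j"
    by simp
qed

text \<open>
  The ring \<open>\<int>[p][[t,z]]\<close> is represented as \<open>\<int>[p][[t]][[z]]\<close>: the outer series variable is \<open>z\<close>, the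
  coefficients are series in \<open>t\<close>.
\<close>

abbreviation p\<^sub>1 :: "int poly fps" where "p\<^sub>1 \<equiv> fps_const [:0, 1:]"
abbreviation t\<^sub>1 :: "int poly fps" where "t\<^sub>1 \<equiv> fps_X"

abbreviation p\<^sub>2 :: "int poly fps fps" where "p\<^sub>2 \<equiv> fps_const p\<^sub>1"
abbreviation t\<^sub>2 :: "int poly fps fps" where "t\<^sub>2 \<equiv> fps_const t\<^sub>1"
abbreviation z\<^sub>2 :: "int poly fps fps" where "z\<^sub>2 \<equiv> fps_X"

end

theory Submission
  imports Defs "HOL-Library.Product_Lexorder"
begin

text \<open>
  The coefficient of \<open>t\<^sup>m\<close> in \<open>t\<^bsup>des \<pi>\<^esup> / (1 - t)\<^bsup>n+1\<^esup>\<close> counts the odd weakly increasing labellings \<open>u\<close> of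
  \<open>{-n..n}\<close> by \<open>{-m..m}\<close> such that \<open>\<pi>\<close> is strictly increasing on every fibre of \<open>u\<close>. An involution \<open>\<pi>\<close> with
  such a labelling is encoded by the table \<open>M(k,l) = #{i. u i = k, u (\<pi> i) = l}\<close>, which is invariant under
  \<open>(k,l) \<mapsto> (l,k)\<close> and \<open>(k,l) \<mapsto> (-k,-l)\<close>. Conversely, list \<open>M(k,l)\<close> copies of each cell \<open>(k,l)\<close>
  lexicographically at the positions \<open>-n, \<dots>, n\<close>: swapping the coordinates of the cells is the involution
  \<open>\<pi>\<close>, and the first coordinate is \<open>u\<close>. Fixed points \<open>\<pi> i = i\<close> come from diagonal cells and fixed points
  \<open>\<pi> i = -i\<close> from the middle copies of antidiagonal cells with odd entry. A table is a free choice of one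
  number for each orbit of cells: \<open>m + 1\<close> diagonal orbits contribute \<open>1 / (1 - p z)\<close> each, \<open>m\<close> antidiagonal
  orbits \<open>(1 + p z) / (1 - z\<^sup>2)\<close>, and the \<open>m\<^sup>2\<close> others \<open>1 / (1 - z\<^sup>2)\<close>.
\<close>

section \<open>Compatible labellings\<close>

text \<open>
  A compatible labelling is determined by its values \<open>0 = a 0 \<le> a 1 \<le> \<dots> \<le> a n \<le> m\<close> at nonnegative
  positions, with strict increase required after the positions in \<open>D\<close>.
\<close>

definition gapped :: "nat set \<Rightarrow> nat \<Rightarrow> nat \<Rightarrow> (nat \<Rightarrow> nat) set" where
  "gapped D n m = {a. a 0 = 0 \<and> (\<forall>i<n. a i + of_bool (i \<in> D) \<le> a (Suc i)) \<and> a n \<le> m \<and> (\<forall>i>n. a i = 0)}"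

lemma gapped_mono:
  assumes "a \<in> gapped D n m" "i \<le> j" "j \<le> n"
  shows "a i \<le> a j"
  using assms(2,3)
proof (induction rule: dec_induct)
  case (step k)
  then have "a k + of_bool (k \<in> D) \<le> a (Suc k)"
    using assms(1) by (simp add: gapped_def)
  with step show ?case
    by simp
qed simp

lemma finite_gapped: "finite (gapped D n m)"
proof (rule finite_subset)
  show "gapped D n m \<subseteq> {a. \<forall>i. (i \<in> {..n} \<longrightarrow> a i \<in> {..m}) \<and> (i \<notin> {..n} \<longrightarrow> a i = 0)}"
  proof safe
    fix a i assume a: "a \<in> gapped D n m" and "i \<le> n"
    then have "a i \<le> a n" "a n \<le> m"
      by (auto intro: gapped_mono simp: gapped_def)
    then show "a i \<le> m" by simp
  qed (auto simp: gapped_def, metis linorder_not_le not_gr_zero)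
qed (rule finite_set_of_finite_funs, auto)

text \<open>Split by the last value. Below \<open>m\<close>, the bound drops to
  \<open>m - 1\<close>. Equal to \<open>m\<close>, its deletion leaves a sequence up to position
  \<open>n\<close> with bound \<open>m - 1\<close> or \<open>m\<close>, according to whether
  \<open>n \<in> D\<close>. The tests for \<open>m = 0\<close> guard against truncated
  subtraction.\<close>

lemma card_gapped_Suc:
  "card (gapped D (Suc n) m) =
     (if m = 0 then 0 else card (gapped D (Suc n) (m - 1))) +
     (if n \<in> D then if m = 0 then 0 else card (gapped D n (m - 1)) else card (gapped D n m))"
proof -
  let ?L = "{a \<in> gapped D (Suc n) m. a (Suc n) < m}"
  let ?T = "{a \<in> gapped D (Suc n) m. a (Suc n) = m}"
  let ?B = "{a \<in> gapped D n m. a n + of_bool (n \<in> D) \<le> m}"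
  have "card (?L \<union> ?T) = card ?L + card ?T"
    by (rule card_Un_disjoint) (auto simp: finite_gapped)
  moreover have "?L \<union> ?T = gapped D (Suc n) m"
    by (auto simp: gapped_def)
  moreover have "?L = (if m = 0 then {} else gapped D (Suc n) (m - 1))"
    by (auto simp: gapped_def)
  moreover have "card ?T = card ?B"
  proof (rule bij_betw_same_card[of "\<lambda>a. a(Suc n := 0)"],
      rule bij_betw_byWitness[where f' = "\<lambda>a. a(Suc n := m)"])
    show "(\<lambda>a. a(Suc n := 0)) ` ?T \<subseteq> ?B"
      by (fastforce simp: gapped_def less_Suc_eq)
    show "(\<lambda>a. a(Suc n := m)) ` ?B \<subseteq> ?T"
      by (auto simp: gapped_def less_Suc_eq)
  qed (auto simp: gapped_def)
  moreover have "?B = (if n \<in> D then if m = 0 then {} else gapped D n (m - 1) else gapped D n m)"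
    by (auto simp: gapped_def)
  ultimately show ?thesis
    by simp
qed

text \<open>By the recursion, multiplying the series for \<open>Suc n\<close> by
  \<open>1 - fps_X\<close> gives the series for \<open>n\<close>, with an extra factor
  \<open>fps_X\<close> exactly when \<open>n \<in> D\<close>.\<close>

lemma gapped_gf:
  "Abs_fps (\<lambda>m. of_nat (card (gapped D n m))) * (1 - fps_X) ^ (n + 1) =
     (fps_X ^ card {i. i < n \<and> i \<in> D} :: 'a::comm_ring_1 fps)"
proof (induction n)
  case 0
  have "gapped D 0 m = {\<lambda>_. 0}" for m
    by (auto simp: gapped_def fun_eq_iff) (metis neq0_conv)
  moreover have "Abs_fps (\<lambda>m. 1) * (1 - fps_X) = (1 :: 'a fps)"
    by (rule fps_ext) (auto simp: right_diff_distrib)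
  ultimately show ?case
    by simp
next
  case (Suc n)
  let ?A = "\<lambda>n. Abs_fps (\<lambda>m. of_nat (card (gapped D n m))) :: 'a fps"
  let ?d = "if n \<in> D then fps_X else (1 :: 'a fps)"
  have step: "?A (Suc n) * (1 - fps_X) = ?d * ?A n"
    by (rule fps_ext) (simp add: right_diff_distrib card_gapped_Suc[of D n])
  have "{i. i < Suc n \<and> i \<in> D} = (if n \<in> D then insert n else id) {i. i < n \<and> i \<in> D}"
    by (auto simp: less_Suc_eq)
  then have d: "(fps_X ^ card {i. i < Suc n \<and> i \<in> D} :: 'a fps) = ?d * fps_X ^ card {i. i < n \<and> i \<in> D}"
    by simp
  have "?A (Suc n) * (1 - fps_X) ^ (Suc n + 1) = (?A (Suc n) * (1 - fps_X)) * (1 - fps_X) ^ (n + 1)"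
    by (simp add: mult_ac)
  also have "\<dots> = ?d * (?A n * (1 - fps_X) ^ (n + 1))"
    unfolding step by (simp only: mult.assoc)
  finally show ?case
    unfolding Suc.IH d .
qed

lemma descent_coeff:
  "fps_nth (fps_X ^ card {i. i < n \<and> i \<in> D} * fps_recip ((1 - fps_X) ^ (n + 1)) :: 'a::comm_ring_1 fps) m =
     of_nat (card (gapped D n m))"
proof -
  let ?q = "(1 - fps_X) ^ (n + 1) :: 'a fps"
  have "?q * fps_recip ?q = 1"
    by (rule fps_recip_right) (simp add: fps_nth_power_0)
  then have "fps_X ^ card {i. i < n \<and> i \<in> D} * fps_recip ?q = Abs_fps (\<lambda>m. of_nat (card (gapped D n m)))"
    unfolding gapped_gf[symmetric] by (simp only: mult.assoc mult_1_right)
  then show ?thesis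
    by simp
qed

text \<open>Vanishing outside \<open>{- int n..int n}\<close> makes a labelling determined by its
  values at the positions.\<close>

definition labellings :: "nat \<Rightarrow> nat \<Rightarrow> (int \<Rightarrow> int) \<Rightarrow> (int \<Rightarrow> int) set" where
  "labellings n m \<pi> = {u. (\<forall>i. u (- i) = - u i) \<and> (\<forall>i. \<bar>u i\<bar> \<le> int m) \<and>
     (\<forall>i. int n < \<bar>i\<bar> \<longrightarrow> u i = 0) \<and> mono_on {- int n..int n} u \<and>
     (\<forall>i\<in>{- int n..int n}. \<forall>j\<in>{- int n..int n}. i < j \<longrightarrow> u i = u j \<longrightarrow> \<pi> i < \<pi> j)}"

lemma labellingsD:
  assumes "u \<in> labellings n m \<pi>"
  shows "u (- i) = - u i" "u 0 = 0" "\<bar>u i\<bar> \<le> int m" "int n < \<bar>i\<bar> \<Longrightarrow> u i = 0"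
    "i \<le> j \<Longrightarrow> \<bar>i\<bar> \<le> int n \<Longrightarrow> \<bar>j\<bar> \<le> int n \<Longrightarrow> u i \<le> u j"
    "i < j \<Longrightarrow> \<bar>i\<bar> \<le> int n \<Longrightarrow> \<bar>j\<bar> \<le> int n \<Longrightarrow> u i = u j \<Longrightarrow> \<pi> i < \<pi> j"
proof -
  have "u (- 0) = - u 0" and mono: "mono_on {- int n..int n} u"
    and fibre: "\<forall>i\<in>{- int n..int n}. \<forall>j\<in>{- int n..int n}. i < j \<longrightarrow> u i = u j \<longrightarrow> \<pi> i < \<pi> j"
    using assms unfolding labellings_def by blast+
  then show "u 0 = 0"
    by simp
  show "u (- i) = - u i" "\<bar>u i\<bar> \<le> int m" "int n < \<bar>i\<bar> \<Longrightarrow> u i = 0"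
    using assms unfolding labellings_def by blast+
  show "i \<le> j \<Longrightarrow> \<bar>i\<bar> \<le> int n \<Longrightarrow> \<bar>j\<bar> \<le> int n \<Longrightarrow> u i \<le> u j"
    using mono_onD[OF mono, of i j] by simp
  show "i < j \<Longrightarrow> \<bar>i\<bar> \<le> int n \<Longrightarrow> \<bar>j\<bar> \<le> int n \<Longrightarrow> u i = u j \<Longrightarrow> \<pi> i < \<pi> j"
    using fibre[rule_format, of i j] by (auto simp: abs_le_iff)
qed

lemma signed_permsD:
  assumes "\<pi> \<in> signed_perms n"
  shows "\<pi> (- i) = - \<pi> i" "\<pi> 0 = 0" "\<pi> permutes {- int n..int n}" "\<pi> i = \<pi> j \<longleftrightarrow> i = j"
proof -
  show "\<pi> (- i) = - \<pi> i"
    using assms by (simp add: signed_perms_def)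
  show "\<pi> 0 = 0"
    using assms permutes_not_in[of \<pi> "{- int n..int n} - {0}" 0] by (simp add: signed_perms_def)
  show p: "\<pi> permutes {- int n..int n}"
    using assms by (auto simp: signed_perms_def intro: permutes_subset)
  show "\<pi> i = \<pi> j \<longleftrightarrow> i = j"
    using permutes_inj[OF p] by (auto simp: inj_def)
qed

text \<open>Oddness reduces a labelling to its nonnegative positions. As labels increase weakly,
  strict increase of \<pi> on fibres only has to be tested between neighbours: the label must rise
  wherever \<pi> descends.\<close>

lemma card_labellings:
  assumes \<pi>: "\<pi> \<in> signed_perms n"
  shows "card (labellings n m \<pi>) = card (gapped {i. \<pi> (int i) > \<pi> (int i + 1)} n m)"
proof -
  let ?D = "{i. \<pi> (int i) > \<pi> (int i + 1)}"
  let ?to = "\<lambda>u i. if i \<le> n then nat (u (int i)) else 0"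
  let ?from = "\<lambda>a i. if \<bar>i\<bar> \<le> int n then sgn i * int (a (nat \<bar>i\<bar>)) else 0"
  note \<pi>_simps = signed_permsD[OF \<pi>]
  have nonneg: "0 \<le> u i" if u: "u \<in> labellings n m \<pi>" and "0 \<le> i" for u i
    using labellingsD(2)[OF u] labellingsD(4)[OF u, of i] labellingsD(5)[OF u, of 0 i] that(2)
    by (cases "i \<le> int n") auto
  have "bij_betw ?to (labellings n m \<pi>) (gapped ?D n m)"
  proof (rule bij_betw_byWitness[where f' = ?from])
    show "\<forall>u\<in>labellings n m \<pi>. ?from (?to u) = u"
    proof (intro ballI ext)
      fix u i assume u: "u \<in> labellings n m \<pi>"
      have "0 \<le> u \<bar>i\<bar>"
        using nonneg[OF u] by simp
      with labellingsD(1,2)[OF u] labellingsD(4)[OF u, of i] show "?from (?to u) i = u i"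
        by (cases "0 :: int" i rule: linorder_cases) auto
    qed
    show "\<forall>a\<in>gapped ?D n m. ?to (?from a) = a"
      by (fastforce simp: gapped_def fun_eq_iff sgn_if)
    show "?to ` labellings n m \<pi> \<subseteq> gapped ?D n m"
    proof safe
      fix u assume u: "u \<in> labellings n m \<pi>"
      have "u 0 = 0" "\<bar>u (int n)\<bar> \<le> int m"
        using labellingsD[OF u] by simp_all
      moreover have "nat (u (int i)) + of_bool (i \<in> ?D) \<le> nat (u (int (Suc i)))" if "i < n" for i
      proof -
        have "u (int i) \<le> u (int i + 1)"
          using that by (intro labellingsD(5)[OF u]) auto
        moreover have "u (int i) \<noteq> u (int i + 1)" if "i \<in> ?D"
          using labellingsD(6)[OF u, of "int i" "int i + 1"] that \<open>i < n\<close> by auto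
        moreover have "0 \<le> u (int i)"
          using nonneg[OF u] by simp
        ultimately show ?thesis
          by (auto simp: add.commute)
      qed
      ultimately show "?to u \<in> gapped ?D n m"
        by (auto simp: gapped_def)
    qed
    show "?from ` gapped ?D n m \<subseteq> labellings n m \<pi>"
    proof safe
      fix a assume a: "a \<in> gapped ?D n m"
      let ?u = "?from a"
      have le: "a i \<le> a j" if "i \<le> j" "j \<le> n" for i j
        using gapped_mono[OF a that] .
      have bound: "a i \<le> m" "a 0 = 0" if "i \<le> n" for i
        using le[OF that] a by (auto simp: gapped_def)
      have gap: "a i + of_bool (i \<in> ?D) \<le> a (Suc i)" if "i < n" for i
        using a that by (simp add: gapped_def)
      \<comment> \<open>Equal values at the two ends force equal values throughout, so no index from
        \<open>i\<close> to \<open>j - 1\<close> lies in \<open>?D\<close>; injectivity of \<pi>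
        makes each ascent strict.\<close>
      have incr: "\<pi> (int i) < \<pi> (int j)" if "i < j" "j \<le> n" "a i = a j" for i j
        using Suc_leI[OF that(1)] that(2,3)
      proof (induction j rule: dec_induct)
        case base
        then have "i \<notin> ?D"
          using gap[of i] by auto
        then have "\<pi> (int i) \<le> \<pi> (int (Suc i))"
          by (simp add: add.commute)
        then show ?case
          using \<pi>_simps(4)[of "int i" "int (Suc i)"] by simp
      next
        case (step j)
        have "a i \<le> a j" "a j \<le> a (Suc j)"
          using step.hyps step.prems(1) by (intro le; simp)+
        with step.prems have eq: "a i = a j" "a j = a (Suc j)"
          by simp_all
        then have "j \<notin> ?D"
          using gap[of j] step.prems by auto
        then have "\<pi> (int j) \<le> \<pi> (int (Suc j))"
          by (simp add: add.commute)
        moreover have "\<pi> (int i) < \<pi> (int j)"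
          using step eq by simp
        ultimately show ?case by simp
      qed
      have pos: "\<pi> i < \<pi> j" if "0 \<le> i" "i < j" "j \<le> int n" "a (nat i) = a (nat j)" for i j
        using incr[of "nat i" "nat j"] that by simp
      have leI: "?u i \<le> ?u j" if "i \<le> j" "i \<in> {- int n..int n}" "j \<in> {- int n..int n}" for i j
      proof -
        have "0 \<le> i \<Longrightarrow> a (nat i) \<le> a (nat j)" "j \<le> 0 \<Longrightarrow> a (nat (- j)) \<le> a (nat (- i))"
          using that by (auto intro!: le)
        then show ?thesis
          using that by (auto simp: sgn_if)
      qed
      have less: "\<pi> i < \<pi> j" if "i < j" "?u i = ?u j" "i \<in> {- int n..int n}" "j \<in> {- int n..int n}" for i j
      proof -
        consider "0 \<le> i" | "j \<le> 0" | "i < 0" "0 < j"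
          by linarith
        then show ?thesis
        proof cases
          case 1
          then show ?thesis
            using that bound(2)[of 0] by (intro pos) (auto simp: sgn_if split: if_splits)
        next
          case 2
          then have "\<pi> (- j) < \<pi> (- i)"
            using that bound(2)[of 0] by (intro pos) (auto simp: sgn_if split: if_splits)
          then show ?thesis
            by (simp add: \<pi>_simps(1))
        next
          case 3
          \<comment> \<open>Labels on opposite sides of 0 have opposite signs, so the common label
            is 0, which is also the label of position 0. Hence \<pi> is positive at
            \<open>- i\<close> and at \<open>j\<close>.\<close>
          then have "a (nat (- i)) = 0" "a (nat j) = 0"
            using that by (auto simp: sgn_if split: if_splits)
          then have "\<pi> 0 < \<pi> (- i)" "\<pi> 0 < \<pi> j"
            using that 3 bound(2)[of 0] by (intro pos; simp)+
          then show ?thesis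
            by (simp add: \<pi>_simps(1,2))
        qed
      qed
      have "\<bar>?u i\<bar> \<le> int m" for i
        using bound(1)[of "nat \<bar>i\<bar>"] by (auto simp: sgn_if)
      moreover have "?u (- i) = - ?u i" for i
        by (simp add: sgn_if)
      moreover have "mono_on {- int n..int n} ?u"
        by (intro mono_onI leI)
      ultimately show "?u \<in> labellings n m \<pi>"
        using less unfolding labellings_def by simp
    qed
  qed
  then show ?thesis
    by (rule bij_betw_same_card)
qed

section \<open>Symmetric tables\<close>

text \<open>An element of a finite linear order is determined by its rank, and the rank of
  \<open>f i\<close> in the image is the rank of \<open>i\<close> in \<open>A\<close>.\<close>

lemma strict_mono_on_image_unique:
  fixes f g :: "'a::linorder \<Rightarrow> 'b::linorder"
  assumes fin: "finite A" and f: "strict_mono_on A f" and g: "strict_mono_on A g"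
    and eq: "f ` A = g ` A" and i: "i \<in> A"
  shows "f i = g i"
proof -
  have rank: "card {y \<in> h ` A. y < h i} = card {j \<in> A. j < i}" if h: "strict_mono_on A h" for h :: "'a \<Rightarrow> 'b"
  proof -
    have "{y \<in> h ` A. y < h i} = h ` {j \<in> A. j < i}"
      using i by (auto simp: strict_mono_on_less[OF h])
    moreover have "inj_on h {j \<in> A. j < i}"
      by (rule inj_on_subset[OF strict_mono_on_imp_inj_on[OF h]]) auto
    ultimately show ?thesis
      by (simp add: card_image)
  qed
  have less: "card {y \<in> f ` A. y < a} < card {y \<in> f ` A. y < b}" if "a < b" "a \<in> f ` A" for a b
    using that fin by (intro psubset_card_mono) auto
  have "f i \<in> f ` A" "g i \<in> f ` A"
    using i eq by auto
  then show ?thesis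
    using rank[OF f] rank[OF g] less[of "f i" "g i"] less[of "g i" "f i"] eq
    by (cases "f i" "g i" rule: linorder_cases) simp_all
qed

text \<open>The sorted list of \<open>E\<close> with indices shifted by \<open>n\<close>, so that
  the middle element sits at position 0.\<close>

lemma ex_strict_mono_enumeration:
  fixes E :: "'a::linorder set"
  assumes "finite E" "card E = 2 * n + 1"
  obtains e where "strict_mono_on {- int n..int n} e" "e ` {- int n..int n} = E"
proof -
  let ?xs = "sorted_list_of_set E" and ?X = "{- int n..int n}"
  have len: "length ?xs = 2 * n + 1"
    using assms by simp
  have less: "?xs ! i < ?xs ! j" if "i < j" "j < 2 * n + 1" for i j
    using sorted_wrt_nth_less[OF strict_sorted_list_of_set that(1), of E] len that(2) by simp
  let ?e = "\<lambda>i. ?xs ! nat (i + int n)"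
  have mono: "strict_mono_on ?X ?e"
    by (intro strict_mono_onI less) auto
  have "?e ` ?X \<subseteq> E"
    using assms len nth_mem[of _ ?xs] by auto
  moreover have "card (?e ` ?X) = card E"
    using strict_mono_on_imp_inj_on[OF mono] assms by (simp add: card_image)
  ultimately have "?e ` ?X = E"
    using assms(1) by (simp add: card_subset_eq)
  with mono show ?thesis
    by (rule that)
qed

lemma card_symmetric_int:
  fixes S :: "int set"
  assumes "finite S" "0 \<in> S" "\<And>i. i \<in> S \<Longrightarrow> - i \<in> S"
  shows "card S = 2 * card {i \<in> S. 0 < i} + 1"
proof -
  let ?P = "{i \<in> S. 0 < i}"
  have "S = insert 0 (?P \<union> uminus ` ?P)"
  proof (intro equalityI subsetI)
    fix x assume x: "x \<in> S"
    show "x \<in> insert 0 (?P \<union> uminus ` ?P)"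
      using x assms(3)[OF x] by (cases "0 :: int" x rule: linorder_cases) (force simp: image_iff)+
  qed (use assms in auto)
  then have "card S = card (insert 0 (?P \<union> uminus ` ?P))"
    by (rule arg_cong)
  also have "\<dots> = card (?P \<union> uminus ` ?P) + 1"
    using assms(1) by (subst card_insert_disjoint) auto
  also have "card (?P \<union> uminus ` ?P) = card ?P + card (uminus ` ?P)"
    using assms(1) by (intro card_Un_disjoint) auto
  also have "card (uminus ` ?P) = card ?P"
    by (simp add: card_image)
  finally show ?thesis by simp
qed

section \<open>Tables and the copies of their cells\<close>

definition box :: "nat \<Rightarrow> (int \<times> int) set" where
  "box m = {- int m..int m} \<times> {- int m..int m}"

lemma finite_box [simp]: "finite (box m)"
  by (simp add: box_def)

text \<open>The entries count the positions \<open>-n, ..., n\<close> by cell, hence the total.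
  Position 0 lies in the cell \<open>(0, 0)\<close> and the other positions there pair up as
  \<open>i\<close>, \<open>-i\<close>, hence the odd entry.\<close>

definition sym_tables :: "nat \<Rightarrow> nat \<Rightarrow> (int \<times> int \<Rightarrow> nat) set" where
  "sym_tables n m = {M. (\<forall>k l. M (l, k) = M (k, l)) \<and> (\<forall>k l. M (- k, - l) = M (k, l)) \<and>
     (\<forall>c. c \<notin> box m \<longrightarrow> M c = 0) \<and> odd (M (0, 0)) \<and> sum M (box m) = 2 * n + 1}"

text \<open>
  The \<open>c\<close> copies of a table entry are spaced symmetrically about \<open>0\<close>, so that negating a cell in all
  coordinates reverses the lexicographic order on cells.
\<close>

definition heights :: "nat \<Rightarrow> int set" where
  "heights c = {r. \<bar>r\<bar> < int c \<and> odd (r + int c)}"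

text \<open>The copies in increasing order, numbered from 0: this is the height that
  \<open>pos\<close> gives to a position of rank \<open>j\<close> in its fibre.\<close>

lemma heights_eq: "heights c = (\<lambda>j. 2 * int j + 1 - int c) ` {..<c}"
proof (intro Set.set_eqI iffI)
  fix r assume "r \<in> heights c"
  then have r: "\<bar>r\<bar> < int c" "odd (r + int c)"
    by (auto simp: heights_def)
  then obtain j where j: "r + int c = 2 * j + 1"
    by (elim oddE)
  with r(1) have "r = 2 * int (nat j) + 1 - int c" "nat j < c"
    by auto
  then show "r \<in> (\<lambda>j. 2 * int j + 1 - int c) ` {..<c}"
    by blast
qed (auto simp: heights_def)

lemma finite_heights [simp]: "finite (heights c)"
  by (simp add: heights_eq)

lemma card_heights: "card (heights c) = c"
  by (simp add: heights_eq card_image inj_on_def)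

text \<open>Nested pairs are compared lexicographically: first coordinate of the cell, then second,
  then height.\<close>

definition cells :: "nat \<Rightarrow> (int \<times> int \<Rightarrow> nat) \<Rightarrow> ((int \<times> int) \<times> int) set" where
  "cells m M = (SIGMA c:box m. heights (M c))"

lemma finite_cells [simp]: "finite (cells m M)"
  by (simp add: cells_def)

lemma card_cells_filter:
  "card {x \<in> cells m M. P x} = (\<Sum>c\<in>box m. card {r \<in> heights (M c). P (c, r)})"
proof -
  have "{x \<in> cells m M. P x} = (SIGMA c:box m. {r \<in> heights (M c). P (c, r)})"
    by (auto simp: cells_def)
  then show ?thesis
    by simp
qed

text \<open>\<open>flip\<close> models \<pi> and keeps the height, because \<pi> preserves the order
  within a fibre; \<open>neg\<close> models negation of positions, which reverses that
  order.\<close>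

definition flip :: "(int \<times> int) \<times> int \<Rightarrow> (int \<times> int) \<times> int" where
  "flip = (\<lambda>((k, l), r). ((l, k), r))"

definition neg :: "(int \<times> int) \<times> int \<Rightarrow> (int \<times> int) \<times> int" where
  "neg = (\<lambda>((k, l), r). ((- k, - l), - r))"

lemma neg_less: "neg x < neg y \<longleftrightarrow> y < x"
  by (auto simp: neg_def less_prod_def' split: prod.splits)

lemma neg_neg [simp]: "neg (neg x) = x"
  by (simp add: neg_def split: prod.splits)

lemma flip_flip [simp]: "flip (flip x) = x"
  by (simp add: flip_def split: prod.splits)

lemma flip_neg: "flip (neg x) = neg (flip x)"
  by (simp add: neg_def flip_def split: prod.splits)

lemma sym_tablesD:
  assumes "M \<in> sym_tables n m"
  shows "M (l, k) = M (k, l)" "M (- k, - l) = M (k, l)" "c \<notin> box m \<Longrightarrow> M c = 0"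
    "odd (M (0, 0))" "sum M (box m) = 2 * n + 1"
  using assms unfolding sym_tables_def by (blast | simp)+

lemma card_cells:
  assumes "M \<in> sym_tables n m"
  shows "card (cells m M) = 2 * n + 1"
  using card_cells_filter[of m M "\<lambda>_. True"] sym_tablesD(5)[OF assms] by (simp add: card_heights)

lemma flip_cells:
  assumes "M \<in> sym_tables n m" "x \<in> cells m M"
  shows "flip x \<in> cells m M"
  using assms(2) sym_tablesD(1)[OF assms(1)] by (auto simp: cells_def flip_def box_def)

lemma neg_cells:
  assumes "M \<in> sym_tables n m" "x \<in> cells m M"
  shows "neg x \<in> cells m M"
  using assms(2) sym_tablesD(2)[OF assms(1)]
  by (auto simp: cells_def neg_def box_def heights_def)

text \<open>Negating both the position and the cell reverses the order twice, so this conjugate of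
  \<open>e\<close> is another increasing enumeration of the same cells and coincides with
  \<open>e\<close>.\<close>

lemma cell_enumeration_odd:
  assumes M: "M \<in> sym_tables n m" and e: "strict_mono_on {- int n..int n} e"
    and im: "e ` {- int n..int n} = cells m M" and i: "i \<in> {- int n..int n}"
  shows "e (- i) = neg (e i)"
proof -
  let ?X = "{- int n..int n}" and ?g = "\<lambda>i. neg (e (- i))"
  have "strict_mono_on ?X ?g"
    using e by (intro strict_mono_onI) (auto simp: neg_less strict_mono_on_def)
  moreover have "?g ` ?X = e ` ?X"
  proof -
    have "uminus ` ?X = ?X"
      by simp
    then have "?g ` ?X = neg ` e ` ?X"
      by (metis (no_types) image_image)
    also have "\<dots> = cells m M"
      unfolding im using neg_cells[OF M] by (force simp: image_iff intro: bexI[of _ "neg _"])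
    finally show ?thesis
      using im by simp
  qed
  ultimately have "e (- i) = ?g (- i)"
    using i e by (intro strict_mono_on_image_unique[of ?X]) auto
  then show ?thesis by simp
qed

section \<open>Labelled involutions and symmetric tables\<close>

definition table :: "nat \<Rightarrow> (int \<Rightarrow> int) \<Rightarrow> (int \<Rightarrow> int) \<Rightarrow> int \<times> int \<Rightarrow> nat" where
  "table n \<pi> u c = card {i \<in> {- int n..int n}. (u i, u (\<pi> i)) = c}"

text \<open>The number of copies \<open>x\<close> of a cell with entry \<open>v\<close> such that
  \<open>flip x\<close> is \<open>x\<close> or \<open>neg x\<close>. On the diagonal all copies
  qualify; on the rest of the antidiagonal only height 0, present exactly for odd
  \<open>v\<close>.\<close>

definition fix_weight :: "int \<times> int \<Rightarrow> nat \<Rightarrow> nat" where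
  "fix_weight c v = (if fst c = snd c then v else if fst c = - snd c then v mod 2 else 0)"

locale labelled_involution =
  fixes n m :: nat and \<pi> u :: "int \<Rightarrow> int"
  assumes invol: "\<pi> \<in> signed_involutions n" and lab: "u \<in> labellings n m \<pi>"
begin

abbreviation "X \<equiv> {- int n..int n}"

lemma signed_perm: "\<pi> \<in> signed_perms n"
  using invol by (simp add: signed_involutions_def)

lemmas \<pi>_minus [simp] = signed_permsD(1)[OF signed_perm]
  and \<pi>_0 [simp] = signed_permsD(2)[OF signed_perm]
  and \<pi>_permutes = signed_permsD(3)[OF signed_perm]
  and \<pi>_eq_iff [simp] = signed_permsD(4)[OF signed_perm]

lemmas u_minus [simp] = labellingsD(1)[OF lab]
  and u_0 [simp] = labellingsD(2)[OF lab]

lemma \<pi>_\<pi> [simp]: "\<pi> (\<pi> i) = i"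
  using invol by (simp add: signed_involutions_def fun_eq_iff)

lemma \<pi>_in_X: "\<pi> i \<in> X \<longleftrightarrow> i \<in> X"
  using permutes_in_image[OF \<pi>_permutes] .

lemma u_mono: "i \<le> j \<Longrightarrow> i \<in> X \<Longrightarrow> j \<in> X \<Longrightarrow> u i \<le> u j"
  by (rule labellingsD(5)[OF lab]) auto

lemma \<pi>_less: "i < j \<Longrightarrow> i \<in> X \<Longrightarrow> j \<in> X \<Longrightarrow> u i = u j \<Longrightarrow> \<pi> i < \<pi> j"
  by (rule labellingsD(6)[OF lab]) auto

definition fibre :: "int \<Rightarrow> int set" where
  "fibre i = {j \<in> X. (u j, u (\<pi> j)) = (u i, u (\<pi> i))}"

text \<open>This recovers from \<pi> and \<open>u\<close> the increasing enumeration of the cells: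
  the height encodes the rank of \<open>i\<close> in its fibre.\<close>

definition pos :: "int \<Rightarrow> (int \<times> int) \<times> int" where
  "pos i = ((u i, u (\<pi> i)), 2 * int (card {j \<in> fibre i. j < i}) + 1 - int (table n \<pi> u (u i, u (\<pi> i))))"

lemma finite_fibre [simp]: "finite (fibre i)"
  by (rule finite_subset[of _ X]) (auto simp: fibre_def)

lemma card_fibre: "card (fibre i) = table n \<pi> u (u i, u (\<pi> i))"
  by (simp add: fibre_def table_def)

text \<open>Applying \<pi> to positions swaps the two labels, and negating positions negates both.
  The fibre of \<open>(0, 0)\<close> is closed under negation and contains 0, so its size is
  odd.\<close>

lemma table_sym_tables: "table n \<pi> u \<in> sym_tables n m"
proof -
  have "table n \<pi> u (l, k) = table n \<pi> u (k, l)" for k l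
    unfolding table_def
    by (rule bij_betw_same_card[of \<pi>], rule bij_betw_byWitness[where f' = \<pi>])
      (use \<pi>_in_X in auto)
  moreover have "table n \<pi> u (- k, - l) = table n \<pi> u (k, l)" for k l
    unfolding table_def
    by (rule bij_betw_same_card[of uminus], rule bij_betw_byWitness[where f' = uminus])
      (auto simp: minus_equation_iff)
  moreover have "table n \<pi> u c = 0" if "c \<notin> box m" for c
  proof -
    have "(u i, u (\<pi> i)) \<in> box m" for i
      using labellingsD(3)[OF lab, of i] labellingsD(3)[OF lab, of "\<pi> i"] by (auto simp: box_def abs_le_iff)
    then have "{i \<in> X. (u i, u (\<pi> i)) = c} = {}"
      using that by blast
    then show ?thesis
      by (simp only: table_def card.empty)
  qed
  moreover have "odd (table n \<pi> u (0, 0))"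
    unfolding table_def by (subst card_symmetric_int) (auto intro: finite_subset[of _ X])
  moreover have "sum (table n \<pi> u) (box m) = 2 * n + 1"
  proof -
    have "(u i, u (\<pi> i)) \<in> box m" for i
      using labellingsD(3)[OF lab, of i] labellingsD(3)[OF lab, of "\<pi> i"] by (auto simp: box_def abs_le_iff)
    then have "(\<Sum>c\<in>box m. \<Sum>i\<in>{i \<in> X. (u i, u (\<pi> i)) = c}. 1) = (\<Sum>i\<in>X. 1 :: nat)"
      by (intro sum.group) auto
    then show ?thesis
      by (simp add: table_def)
  qed
  ultimately show ?thesis
    unfolding sym_tables_def by blast
qed

text \<open>Within a cell the rank increases. Between cells \<open>u\<close> decides; if
  \<open>u i = u j\<close>, then \<open>\<pi> i < \<pi> j\<close> by compatibility, so the second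
  labels are in weak order as well.\<close>

lemma pos_strict_mono: "strict_mono_on X pos"
proof (rule strict_mono_onI)
  fix i j assume ij: "i \<in> X" "j \<in> X" "i < j"
  show "pos i < pos j"
  proof (cases "(u i, u (\<pi> i)) = (u j, u (\<pi> j))")
    case True
    then have eq: "fibre i = fibre j" "u i = u j" "u (\<pi> i) = u (\<pi> j)"
      by (auto simp: fibre_def)
    have "i \<in> fibre j"
      using ij(1) eq(2,3) by (simp add: fibre_def)
    then have "{k \<in> fibre i. k < i} \<subset> {k \<in> fibre j. k < j}"
      unfolding eq(1) using ij(3) by auto
    then have "card {k \<in> fibre i. k < i} < card {k \<in> fibre j. k < j}"
      by (intro psubset_card_mono) auto
    then show ?thesis
      using eq by (simp add: pos_def)
  next
    case False
    have "u i \<le> u j"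
      using ij by (simp add: u_mono)
    moreover have "u (\<pi> i) \<le> u (\<pi> j)" if "u i = u j"
      using \<pi>_less[of i j] ij that \<pi>_in_X by (intro u_mono) auto
    ultimately show ?thesis
      using False by (auto simp: pos_def less_prod_def')
  qed
qed

text \<open>Ranks stay below the size of the fibre, which gives one inclusion; both sides have
  \<open>2 * n + 1\<close> elements.\<close>

lemma pos_image: "pos ` X = cells m (table n \<pi> u)"
proof (rule card_subset_eq)
  show "pos ` X \<subseteq> cells m (table n \<pi> u)"
  proof (rule image_subsetI)
    fix i assume "i \<in> X"
    then have "{j \<in> fibre i. j < i} \<subset> fibre i"
      by (auto simp: fibre_def)
    then have "card {j \<in> fibre i. j < i} < card (fibre i)"
      by (intro psubset_card_mono) auto
    then have "card {j \<in> fibre i. j < i} < table n \<pi> u (u i, u (\<pi> i))"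
      by (simp add: card_fibre)
    then show "pos i \<in> cells m (table n \<pi> u)"
      using sym_tablesD(3)[OF table_sym_tables, of "(u i, u (\<pi> i))"]
      by (auto simp: pos_def cells_def heights_eq)
  qed
  show "card (pos ` X) = card (cells m (table n \<pi> u))"
    using card_cells[OF table_sym_tables] strict_mono_on_imp_inj_on[OF pos_strict_mono]
    by (simp add: card_image)
qed simp

lemma pos_minus: "i \<in> X \<Longrightarrow> pos (- i) = neg (pos i)"
  by (rule cell_enumeration_odd[OF table_sym_tables pos_strict_mono pos_image])

text \<open>\<pi> maps the fibre of \<open>i\<close> increasingly onto that of
  \<open>\<pi> i\<close>, so the ranks agree.\<close>

lemma pos_\<pi>:
  assumes "i \<in> X"
  shows "pos (\<pi> i) = flip (pos i)"
proof -
  have "{j \<in> fibre (\<pi> i). j < \<pi> i} = \<pi> ` {j \<in> fibre i. j < i}"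
  proof (intro equalityI subsetI)
    fix j assume "j \<in> {j \<in> fibre (\<pi> i). j < \<pi> i}"
    then have "\<pi> j \<in> {j \<in> fibre i. j < i}"
      using \<pi>_less[of j "\<pi> i"] assms \<pi>_in_X by (auto simp: fibre_def)
    then show "j \<in> \<pi> ` {j \<in> fibre i. j < i}"
      by (metis \<pi>_\<pi> imageI)
  qed (use \<pi>_less assms \<pi>_in_X in \<open>auto simp: fibre_def\<close>)
  moreover have "inj_on \<pi> A" for A
    by (simp add: inj_on_def)
  ultimately show ?thesis
    using sym_tablesD(1)[OF table_sym_tables] by (simp add: pos_def flip_def card_image)
qed

text \<open>Count the fixed positions among \<open>-n, ..., n\<close>: they come in pairs, plus
  position 0. Through \<open>pos\<close> they become the copies that \<open>flip\<close> fixes or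
  sends to their negative.\<close>

lemma fix_B_table:
  "2 * fix_B n \<pi> + 1 = (\<Sum>c\<in>box m. fix_weight c (table n \<pi> u c))"
proof -
  let ?M = "table n \<pi> u"
  let ?F = "{i \<in> X. \<bar>\<pi> i\<bar> = \<bar>i\<bar>}" and ?P = "\<lambda>x. flip x = x \<or> flip x = neg x"
  have inj: "pos i = pos j \<longleftrightarrow> i = j" if "i \<in> X" "j \<in> X" for i j
    using inj_on_eq_iff[OF strict_mono_on_imp_inj_on[OF pos_strict_mono]] that by blast
  have fix_iff: "\<bar>\<pi> i\<bar> = \<bar>i\<bar> \<longleftrightarrow> ?P (pos i)" if i: "i \<in> X" for i
  proof -
    have "\<bar>\<pi> i\<bar> = \<bar>i\<bar> \<longleftrightarrow> \<pi> i = i \<or> \<pi> i = - i"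
      by linarith
    also have "\<dots> \<longleftrightarrow> pos (\<pi> i) = pos i \<or> pos (\<pi> i) = pos (- i)"
      using i \<pi>_in_X by (subst (1 2) inj) auto
    finally show ?thesis
      using i by (simp add: pos_\<pi> pos_minus)
  qed
  have height: "card {r \<in> heights (?M c). ?P (c, r)} = fix_weight c (?M c)" for c
  proof -
    obtain k l where c: "c = (k, l)"
      by (cases c)
    \<comment> \<open>Off the diagonal \<open>flip x = neg x\<close> forces \<open>k = - l\<close>
      and \<open>r = 0\<close>, and 0 is a height only for an odd entry.\<close>
    have "{r \<in> heights (?M c). ?P (c, r)} =
        (if k = l then heights (?M c) else if k = - l \<and> odd (?M c) then {0} else {})"
      unfolding c by (auto simp: flip_def neg_def heights_def intro: Suc_leI odd_pos)
    then show ?thesis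
      by (auto simp: c fix_weight_def card_heights odd_iff_mod_2_eq_one even_iff_mod_2_eq_zero)
  qed
  have "2 * fix_B n \<pi> + 1 = card ?F"
  proof -
    have "{i \<in> ?F. 0 < i} = {i \<in> {1..int n}. \<bar>\<pi> i\<bar> = i}"
      by auto
    then have "fix_B n \<pi> = card {i \<in> ?F. 0 < i}"
      by (simp only: fix_B_def)
    moreover have "card ?F = 2 * card {i \<in> ?F. 0 < i} + 1"
      by (rule card_symmetric_int) (auto intro: finite_subset[of _ X])
    ultimately show ?thesis by (simp only:)
  qed
  also have "\<dots> = card (pos ` ?F)"
    by (intro card_image[symmetric] inj_on_subset[OF strict_mono_on_imp_inj_on[OF pos_strict_mono]]) auto
  also have "pos ` ?F = {x \<in> cells m ?M. ?P x}"
    using fix_iff by (auto simp: pos_image[symmetric])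
  also have "card \<dots> = (\<Sum>c\<in>box m. card {r \<in> heights (?M c). ?P (c, r)})"
    by (rule card_cells_filter)
  finally show ?thesis
    by (simp only: height)
qed

end

text \<open>The table determines the cells, hence their increasing enumeration \<open>pos\<close>;
  from it \<pi> is read off through \<open>flip\<close> and \<open>u\<close> as the first
  coordinate.\<close>

lemma table_inj:
  assumes "labelled_involution n m \<pi> u" "labelled_involution n m \<pi>' u'"
    and eq: "table n \<pi> u = table n \<pi>' u'"
  shows "\<pi> = \<pi>' \<and> u = u'"
proof -
  interpret A: labelled_involution n m \<pi> u by fact
  interpret B: labelled_involution n m \<pi>' u' by fact
  have pos_eq: "A.pos i = B.pos i" if "i \<in> A.X" for i
    using A.pos_image B.pos_image eq A.pos_strict_mono B.pos_strict_mono that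
    by (intro strict_mono_on_image_unique[of A.X]) auto
  have "\<pi> i = \<pi>' i \<and> u i = u' i" for i
  proof (cases "i \<in> A.X")
    case True
    have "A.pos (\<pi> i) = B.pos (\<pi>' i)"
      using True pos_eq by (simp only: A.pos_\<pi> B.pos_\<pi>)
    also have "\<dots> = A.pos (\<pi>' i)"
      using True B.\<pi>_in_X by (intro pos_eq[symmetric]) auto
    finally have "\<pi> i = \<pi>' i"
      using inj_on_eq_iff[OF strict_mono_on_imp_inj_on[OF A.pos_strict_mono]] True A.\<pi>_in_X B.\<pi>_in_X
      by blast
    then show ?thesis
      using pos_eq[OF True] by (simp add: A.pos_def B.pos_def)
  next
    case False
    then show ?thesis
      using permutes_not_in[OF A.\<pi>_permutes] permutes_not_in[OF B.\<pi>_permutes]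
        labellingsD(4)[OF A.lab, of i] labellingsD(4)[OF B.lab, of i] by auto
  qed
  then show ?thesis
    by auto
qed

text \<open>Enumerate the cells increasingly by \<open>e\<close>, transport \<open>flip\<close> to
  positions to obtain \<pi>, and let \<open>u\<close> be the first coordinate. Oddness of both is
  \<open>cell_enumeration_odd\<close>.\<close>

lemma table_surj:
  assumes M: "M \<in> sym_tables n m"
  obtains \<pi> u where "labelled_involution n m \<pi> u" "table n \<pi> u = M"
proof -
  let ?X = "{- int n..int n}"
  obtain e where e: "strict_mono_on ?X e" and im: "e ` ?X = cells m M"
    using ex_strict_mono_enumeration[OF finite_cells card_cells[OF M]] .
  have e_minus: "e (- i) = neg (e i)" if "i \<in> ?X" for i
    using cell_enumeration_odd[OF M e im that] .
  have inj: "e i = e j \<longleftrightarrow> i = j" if "i \<in> ?X" "j \<in> ?X" for i j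
    using inj_on_eq_iff[OF strict_mono_on_imp_inj_on[OF e]] that by blast
  define \<pi> where "\<pi> i = (if i \<in> ?X then inv_into ?X e (flip (e i)) else i)" for i
  define u where "u i = (if i \<in> ?X then fst (fst (e i)) else 0)" for i
  have flip_e: "flip (e i) \<in> e ` ?X" if "i \<in> ?X" for i
    using flip_cells[OF M] im that by blast
  have \<pi>_X [simp]: "\<pi> i \<in> ?X \<longleftrightarrow> i \<in> ?X" for i
    using inv_into_into[OF flip_e] by (auto simp: \<pi>_def simp del: atLeastAtMost_iff)
  have e_\<pi>: "e (\<pi> i) = flip (e i)" if "i \<in> ?X" for i
    using f_inv_into_f[OF flip_e[OF that]] that by (simp add: \<pi>_def)
  have \<pi>_\<pi>: "\<pi> (\<pi> i) = i" for i
  proof (cases "i \<in> ?X")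
    case True
    then have "e (\<pi> (\<pi> i)) = e i"
      using \<pi>_X by (simp add: e_\<pi> del: atLeastAtMost_iff)
    then show ?thesis
      using True \<pi>_X inj by blast
  next
    case False
    then have "\<pi> i = i"
      by (simp add: \<pi>_def del: atLeastAtMost_iff)
    then show ?thesis by simp
  qed
  have \<pi>_minus: "\<pi> (- i) = - \<pi> i" for i
  proof (cases "i \<in> ?X")
    case True
    then have X: "- i \<in> ?X" "\<pi> i \<in> ?X" "- \<pi> i \<in> ?X" "\<pi> (- i) \<in> ?X"
      using \<pi>_X[of i] \<pi>_X[of "- i"] by auto
    have "e (\<pi> (- i)) = e (- \<pi> i)"
      using True X by (simp only: e_\<pi> e_minus flip_neg)
    then show ?thesis
      using X inj by blast
  qed (auto simp: \<pi>_def)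
  have \<pi>_0: "\<pi> 0 = 0"
    using \<pi>_minus[of 0] by simp
  have "\<pi> permutes ?X - {0}"
    unfolding permutes_def
  proof (intro conjI allI impI)
    fix i assume "i \<notin> ?X - {0}"
    then show "\<pi> i = i"
      using \<pi>_0 by (auto simp: \<pi>_def)
  next
    fix i
    show "\<exists>!j. \<pi> j = i"
      by (metis \<pi>_\<pi>)
  qed
  then have inv: "\<pi> \<in> signed_involutions n"
    using \<pi>_minus \<pi>_\<pi> by (auto simp: signed_involutions_def signed_perms_def)
  have u_e: "u i = fst (fst (e i))" if "i \<in> ?X" for i
    using that by (simp add: u_def)
  have u_\<pi>: "u (\<pi> i) = snd (fst (e i))" if "i \<in> ?X" for i
    using e_\<pi>[OF that] u_e[of "\<pi> i"] that \<pi>_X[of i] by (simp add: flip_def split: prod.splits del: \<pi>_X)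
  have less: "e i < e j" if "i < j" "i \<in> ?X" "j \<in> ?X" for i j
    using strict_mono_onD[OF e that(2,3,1)] .
  have "u (- i) = - u i" for i
    using e_minus[of i] by (auto simp: u_def neg_def split: prod.splits)
  moreover have "\<bar>u i\<bar> \<le> int m" for i
  proof (cases "i \<in> ?X")
    case True
    then have "e i \<in> cells m M"
      using im by blast
    then show ?thesis
      using u_e[OF True] by (auto simp: cells_def box_def)
  qed (auto simp: u_def)
  moreover have "mono_on ?X u"
  proof (rule mono_onI)
    fix i j assume "i \<in> ?X" "j \<in> ?X" "i \<le> j"
    then show "u i \<le> u j"
      using less[of i j] u_e by (cases "i = j") (auto simp: less_prod_def')
  qed
  moreover have "\<pi> i < \<pi> j" if ij: "i < j" "u i = u j" "i \<in> ?X" "j \<in> ?X" for i j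
  proof -
    \<comment> \<open>With equal first coordinates, the order is decided by the second coordinate
      and then the height, and \<open>flip\<close> keeps this comparison.\<close>
    have "flip (e i) < flip (e j)"
      using less[OF ij(1,3,4)] ij u_e by (auto simp: flip_def less_prod_def' split: prod.splits)
    then have "e (\<pi> i) < e (\<pi> j)"
      using ij by (simp add: e_\<pi>)
    then show ?thesis
      using less[of "\<pi> j" "\<pi> i"] \<pi>_X ij by (metis less_asym' linorder_neqE)
  qed
  moreover have "u i = 0" if "int n < \<bar>i\<bar>" for i
    using that by (auto simp: u_def)
  ultimately have "u \<in> labellings n m \<pi>"
    unfolding labellings_def by blast
  then have "labelled_involution n m \<pi> u"
    using inv by unfold_locales
  moreover have "table n \<pi> u c = M c" for c
  proof -
    have "{i \<in> ?X. (u i, u (\<pi> i)) = c} = {i \<in> ?X. fst (e i) = c}"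
      using u_e u_\<pi> by (auto simp: prod_eq_iff)
    then have "table n \<pi> u c = card {i \<in> ?X. fst (e i) = c}"
      by (simp only: table_def)
    also have "\<dots> = card (e ` {i \<in> ?X. fst (e i) = c})"
      by (intro card_image[symmetric] inj_on_subset[OF strict_mono_on_imp_inj_on[OF e]]) auto
    also have "e ` {i \<in> ?X. fst (e i) = c} = {x \<in> cells m M. fst x = c}"
      unfolding im[symmetric] by auto
    also have "\<dots> = {c} \<times> heights (M c)"
      using sym_tablesD(3)[OF M, of c] by (cases "c \<in> box m") (auto simp: cells_def heights_def)
    finally show ?thesis
      by (simp add: card_heights card_cartesian_product)
  qed
  ultimately show ?thesis
    using that by blast
qed

section \<open>Orbits of cells\<close>

text \<open>
  Orbit representatives for the group generated by \<open>(k, l) \<mapsto> (l, k)\<close> and \<open>(k, l) \<mapsto> (- k, - l)\<close>.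
\<close>

definition reps :: "nat \<Rightarrow> (int \<times> int) set" where
  "reps m = {(x, y) \<in> box m. 0 \<le> x \<and> x \<le> \<bar>y\<bar> \<and> (x = 0 \<longrightarrow> 0 \<le> y)}"

text \<open>The two absolute values and the sign of the product are invariants that together
  determine the orbit.\<close>

definition rep :: "int \<times> int \<Rightarrow> int \<times> int" where
  "rep = (\<lambda>(k, l). (min \<bar>k\<bar> \<bar>l\<bar>, if k * l < 0 then - max \<bar>k\<bar> \<bar>l\<bar> else max \<bar>k\<bar> \<bar>l\<bar>))"

text \<open>Among representatives, \<open>fst c = \<bar>snd c\<bar>\<close> picks out the diagonal
  and the antidiagonal.\<close>

definition orbit_size :: "int \<times> int \<Rightarrow> nat" where
  "orbit_size c = (if c = (0, 0) then 1 else if fst c = \<bar>snd c\<bar> then 2 else 4)"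

lemma reps_subset: "reps m \<subseteq> box m"
  by (auto simp: reps_def)

lemma finite_reps [simp]: "finite (reps m)"
  using finite_subset[OF reps_subset] by simp

lemma rep_in_reps: "c \<in> box m \<Longrightarrow> rep c \<in> reps m"
  by (auto simp: rep_def reps_def box_def min_def max_def abs_if mult_less_0_iff not_less split: prod.splits if_splits)

lemma rep_reps: "c \<in> reps m \<Longrightarrow> rep c = c"
  by (auto simp: rep_def reps_def min_def max_def abs_if mult_less_0_iff split: prod.splits if_splits)

lemma rep_swap: "rep (l, k) = rep (k, l)"
  by (simp add: rep_def min.commute max.commute mult.commute)

lemma rep_minus: "rep (- k, - l) = rep (k, l)"
  by (simp add: rep_def)

lemma rep_eqD:
  assumes "rep (k, l) = (x, y)"
  shows "(k, l) = (x, y) \<or> (k, l) = (- x, - y) \<or> (k, l) = (y, x) \<or> (k, l) = (- y, - x)"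
  using assms
  by (auto simp: rep_def min_def max_def abs_if mult_less_0_iff not_less split: if_splits)

lemma orbit_eq:
  assumes "(x, y) \<in> reps m"
  shows "{c \<in> box m. rep c = (x, y)} = {(x, y), (- x, - y), (y, x), (- y, - x)}"
proof (intro equalityI subsetI)
  fix c assume "c \<in> {c \<in> box m. rep c = (x, y)}"
  then show "c \<in> {(x, y), (- x, - y), (y, x), (- y, - x)}"
    using rep_eqD[of "fst c" "snd c" x y] by auto
next
  fix c assume "c \<in> {(x, y), (- x, - y), (y, x), (- y, - x)}"
  then show "c \<in> {c \<in> box m. rep c = (x, y)}"
    using rep_reps[OF assms] rep_swap[of x y] rep_minus[of x y] rep_minus[of y x] assms
    by (auto simp: reps_def box_def)
qed

lemma card_orbit:
  assumes "c \<in> reps m"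
  shows "card {d \<in> box m. rep d = c} = orbit_size c"
proof -
  obtain x y where c: "c = (x, y)"
    by (cases c)
  have xy: "0 \<le> x" "x \<le> \<bar>y\<bar>" "x = 0 \<Longrightarrow> 0 \<le> y"
    using assms by (auto simp: reps_def c)
  consider "x = 0" "y = 0" | "x = y" "x \<noteq> 0" | "x = - y" "x \<noteq> 0" | "x \<noteq> y" "x \<noteq> - y"
    by linarith
  then have "card {(x, y), (- x, - y), (y, x), (- y, - x)} = orbit_size (x, y)"
    by cases (use xy in \<open>auto simp: orbit_size_def card_insert_if\<close>)
  then show ?thesis
    using orbit_eq[of x y m] assms c by simp
qed

lemma sym_rep:
  fixes g :: "int \<times> int \<Rightarrow> 'b"
  assumes "\<And>k l. g (l, k) = g (k, l)" "\<And>k l. g (- k, - l) = g (k, l)"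
  shows "g (rep c) = g c"
proof -
  obtain k l x y where c: "c = (k, l)" "rep c = (x, y)"
    by (metis surj_pair)
  then show ?thesis
    using rep_eqD[of k l x y] assms(1)[of x y] assms(2)[of x y] assms(2)[of y x] by auto
qed

lemma sum_box_sym:
  fixes g :: "int \<times> int \<Rightarrow> nat"
  assumes "\<And>k l. g (l, k) = g (k, l)" "\<And>k l. g (- k, - l) = g (k, l)"
  shows "sum g (box m) = (\<Sum>c\<in>reps m. orbit_size c * g c)"
proof -
  have "sum g (box m) = (\<Sum>c\<in>reps m. \<Sum>d\<in>{d \<in> box m. rep d = c}. g d)"
    by (rule sum.group[symmetric]) (auto intro: rep_in_reps)
  also have "\<dots> = (\<Sum>c\<in>reps m. \<Sum>d\<in>{d \<in> box m. rep d = c}. g c)"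
    using sym_rep[of g, OF assms] by (intro sum.cong refl) auto
  finally show ?thesis
    by (simp add: card_orbit)
qed

text \<open>
  Half of the contribution of an orbit to the table sum, i.e. its contribution to \<open>n\<close>; at the origin
  the odd entry \<open>2 d + 1\<close> contributes \<open>d\<close>, because position \<open>0\<close> is not counted.
\<close>

definition rep_degree :: "int \<times> int \<Rightarrow> nat \<Rightarrow> nat" where
  "rep_degree c v = (if c = (0, 0) then v div 2 else if fst c = \<bar>snd c\<bar> then v else 2 * v)"

text \<open>Inverse to \<open>rep_degree\<close>, for odd entries at the origin and for even degrees
  off both diagonals.\<close>

definition rep_value :: "int \<times> int \<Rightarrow> nat \<Rightarrow> nat" where
  "rep_value c d = (if c = (0, 0) then 2 * d + 1 else if fst c = \<bar>snd c\<bar> then d else d div 2)"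

text \<open>The multiplicity of a representative is its degree. Multisets of size \<open>n\<close>
  index the terms in the \<open>n\<close>-th coefficient of a product of series.\<close>

definition even_multisets :: "nat \<Rightarrow> nat \<Rightarrow> (int \<times> int) multiset set" where
  "even_multisets n m =
     {A \<in> multisets_of_size (reps m) n. \<forall>c\<in>reps m. fst c \<noteq> \<bar>snd c\<bar> \<longrightarrow> even (count A c)}"

definition rep_mset :: "nat \<Rightarrow> (int \<times> int \<Rightarrow> nat) \<Rightarrow> (int \<times> int) multiset" where
  "rep_mset m M = (\<Sum>c\<in>reps m. replicate_mset (rep_degree c (M c)) c)"

lemma count_rep_mset: "c \<in> reps m \<Longrightarrow> count (rep_mset m M) c = rep_degree c (M c)"
  by (simp add: rep_mset_def count_sum)

text \<open>Orbit size times entry is twice the degree, except for an additional 1 at the origin.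
  The same holds for the fixed-point weights, which vanish off both diagonals.\<close>

lemma sum_table_reps:
  assumes sym: "\<And>k l. M (l, k) = M (k, l)" "\<And>k l. M (- k, - l) = M (k, l)" and odd: "odd (M (0, 0))"
  shows "sum M (box m) = 2 * (\<Sum>c\<in>reps m. rep_degree c (M c)) + 1"
    "(\<Sum>c\<in>box m. fix_weight c (M c)) = 2 * (\<Sum>c\<in>reps m. fix_weight c (rep_degree c (M c))) + 1"
proof -
  have zero: "(0, 0) \<in> reps m"
    by (simp add: reps_def box_def)
  have "sum M (box m) = (\<Sum>c\<in>reps m. 2 * rep_degree c (M c) + (if c = (0, 0) then 1 else 0))"
    unfolding sum_box_sym[of M, OF sym]
    using odd by (intro sum.cong refl) (auto simp: orbit_size_def rep_degree_def)
  then show "sum M (box m) = 2 * (\<Sum>c\<in>reps m. rep_degree c (M c)) + 1"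
    using zero by (simp add: sum.distrib sum_distrib_left)
  have "(\<Sum>c\<in>box m. fix_weight c (M c)) = (\<Sum>c\<in>reps m. orbit_size c * fix_weight c (M c))"
    by (rule sum_box_sym) (auto simp: fix_weight_def sym)
  also have "\<dots> = (\<Sum>c\<in>reps m. 2 * fix_weight c (rep_degree c (M c)) + (if c = (0, 0) then 1 else 0))"
    using odd by (intro sum.cong refl)
      (auto simp: orbit_size_def rep_degree_def fix_weight_def reps_def abs_if split: if_splits)
  finally show "(\<Sum>c\<in>box m. fix_weight c (M c)) = 2 * (\<Sum>c\<in>reps m. fix_weight c (rep_degree c (M c))) + 1"
    using zero by (simp add: sum.distrib sum_distrib_left)
qed

lemma bij_rep_mset: "bij_betw (rep_mset m) (sym_tables n m) (even_multisets n m)"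
proof -
  \<comment> \<open>The inverse decodes the multiplicity of a representative and copies the entry to
    its whole orbit.\<close>
  let ?tab = "\<lambda>A c. if c \<in> box m then rep_value (rep c) (count A (rep c)) else 0"
  have zero: "(0, 0) \<in> reps m" "rep (0, 0) = (0, 0)"
    by (simp_all add: reps_def box_def rep_def)
  have size: "size A = (\<Sum>c\<in>reps m. count A c)" if "set_mset A \<subseteq> reps m" for A
    unfolding size_multiset_overloaded_eq
    using that by (intro sum.mono_neutral_left) (auto simp: count_eq_zero_iff)
  have sub: "set_mset (rep_mset m M) \<subseteq> reps m" for M
    by (auto simp: rep_mset_def set_mset_sum)
  show ?thesis
  proof (rule bij_betw_byWitness[where f' = ?tab])
    show "\<forall>M\<in>sym_tables n m. ?tab (rep_mset m M) = M"
    proof (intro ballI ext)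
      fix M c assume M: "M \<in> sym_tables n m"
      note D = sym_tablesD[OF M]
      show "?tab (rep_mset m M) c = M c"
      proof (cases "c \<in> box m")
        case True
        have "rep_value (rep c) (rep_degree (rep c) (M (rep c))) = M (rep c)"
          using D(4) by (auto simp: rep_value_def rep_degree_def)
        then show ?thesis
          using True sym_rep[of M c] D(1,2) by (simp add: count_rep_mset rep_in_reps)
      qed (simp add: D(3))
    qed
    show "\<forall>A\<in>even_multisets n m. rep_mset m (?tab A) = A"
    proof (intro ballI multiset_eqI)
      fix A c assume A: "A \<in> even_multisets n m"
      show "count (rep_mset m (?tab A)) c = count A c"
      proof (cases "c \<in> reps m")
        case True
        then have "c \<in> box m" "rep c = c"
          using reps_subset rep_reps by auto
        then show ?thesis
          using True A by (auto simp: count_rep_mset rep_degree_def rep_value_def even_multisets_def)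
      next
        case False
        then have "c \<notin># A" "c \<notin># rep_mset m (?tab A)"
          using A sub by (auto simp: even_multisets_def multisets_of_size_def)
        then show ?thesis
          by (simp add: count_eq_zero_iff[symmetric])
      qed
    qed
    show "rep_mset m ` sym_tables n m \<subseteq> even_multisets n m"
    proof (rule image_subsetI)
      fix M assume M: "M \<in> sym_tables n m"
      note D = sym_tablesD[OF M]
      have "2 * n + 1 = 2 * (\<Sum>c\<in>reps m. rep_degree c (M c)) + 1"
        using sum_table_reps(1)[of M, OF D(1,2,4)] D(5) by simp
      then have "size (rep_mset m M) = n"
        using sub by (simp add: size count_rep_mset)
      then show "rep_mset m M \<in> even_multisets n m"
        using sub by (auto simp: even_multisets_def multisets_of_size_def count_rep_mset rep_degree_def)
    qed
    show "?tab ` even_multisets n m \<subseteq> sym_tables n m"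
    proof (rule image_subsetI)
      fix A assume A: "A \<in> even_multisets n m"
      let ?M = "?tab A"
      have sym: "?M (l, k) = ?M (k, l)" "?M (- k, - l) = ?M (k, l)" for k l
        by (auto simp: rep_swap[of k l] rep_minus box_def)
      have odd: "odd (?M (0, 0))"
        using zero by (simp add: box_def rep_value_def)
      have "(\<Sum>c\<in>reps m. rep_degree c (?M c)) = (\<Sum>c\<in>reps m. count A c)"
        using A reps_subset rep_reps
        by (intro sum.cong refl) (auto simp: rep_degree_def rep_value_def even_multisets_def subset_iff)
      also have "\<dots> = n"
        using A size[of A] by (simp add: even_multisets_def multisets_of_size_def)
      finally have "sum ?M (box m) = 2 * n + 1"
        using sum_table_reps(1)[of ?M m, OF sym odd] by (simp only:)
      with sym odd show "?M \<in> sym_tables n m"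
        unfolding sym_tables_def by auto
    qed
  qed
qed

section \<open>Generating functions\<close>

text \<open>Labelled involutions correspond to tables, and tables to multisets. Comparing
  \<open>fix_B_table\<close> with \<open>sum_table_reps\<close> splits the number of fixed points
  over the representatives.\<close>

lemma sum_involutions_multisets:
  fixes p :: "'a::comm_ring_1"
  shows "(\<Sum>\<pi>\<in>signed_involutions n. of_nat (card (labellings n m \<pi>)) * p ^ fix_B n \<pi>) =
           (\<Sum>A\<in>even_multisets n m. \<Prod>c\<in>reps m. p ^ fix_weight c (count A c))"
proof -
  let ?S = "SIGMA \<pi>:signed_involutions n. labellings n m \<pi>"
  have loc: "labelled_involution n m \<pi> u \<longleftrightarrow> (\<pi>, u) \<in> ?S" for \<pi> u
    by (auto simp: labelled_involution_def)
  have "bij_betw (\<lambda>(\<pi>, u). table n \<pi> u) ?S (sym_tables n m)"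
    unfolding bij_betw_def
  proof (intro conjI inj_onI equalityI subsetI)
    fix x y assume "x \<in> ?S" "y \<in> ?S" and "(\<lambda>(\<pi>, u). table n \<pi> u) x = (\<lambda>(\<pi>, u). table n \<pi> u) y"
    then show "x = y"
      using table_inj[of n m "fst x" "snd x" "fst y" "snd y"]
      by (simp add: loc prod_eq_iff case_prod_unfold)
  next
    fix M assume "M \<in> (\<lambda>(\<pi>, u). table n \<pi> u) ` ?S"
    then obtain x where M: "M = table n (fst x) (snd x)" and "x \<in> ?S"
      by (elim imageE) (simp only: case_prod_unfold)
    then interpret labelled_involution n m "fst x" "snd x"
      by (simp only: loc prod.collapse)
    show "M \<in> sym_tables n m"
      unfolding M by (rule table_sym_tables)
  next
    fix M assume "M \<in> sym_tables n m"
    then obtain \<pi> u where "labelled_involution n m \<pi> u" "table n \<pi> u = M"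
      by (rule table_surj)
    then show "M \<in> (\<lambda>(\<pi>, u). table n \<pi> u) ` ?S"
      using loc by (intro image_eqI[of _ _ "(\<pi>, u)"]) simp_all
  qed
  from bij_betw_trans[OF this bij_rep_mset]
  have bij: "bij_betw (\<lambda>(\<pi>, u). rep_mset m (table n \<pi> u)) ?S (even_multisets n m)"
    by (simp add: comp_def case_prod_unfold)
  have fix_eq: "fix_B n \<pi> = (\<Sum>c\<in>reps m. fix_weight c (count (rep_mset m (table n \<pi> u)) c))"
    if "(\<pi>, u) \<in> ?S" for \<pi> u
  proof -
    interpret labelled_involution n m \<pi> u
      using that loc by blast
    note D = sym_tablesD[OF table_sym_tables]
    have "2 * fix_B n \<pi> + 1 =
        2 * (\<Sum>c\<in>reps m. fix_weight c (rep_degree c (table n \<pi> u c))) + 1"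
      using fix_B_table sum_table_reps(2)[of "table n \<pi> u" m, OF D(1,2,4)] by simp
    then show ?thesis
      by (simp add: count_rep_mset)
  qed
  have fin_perm: "finite (signed_involutions n)"
  proof (rule finite_subset)
    show "signed_involutions n \<subseteq> {\<pi>. \<pi> permutes {- int n..int n}}"
      using signed_permsD(3) by (auto simp: signed_involutions_def)
  qed (simp add: finite_permutations)
  have fin_lab: "finite (labellings n m \<pi>)" for \<pi>
  proof (rule finite_subset)
    show "labellings n m \<pi> \<subseteq> {u. \<forall>i. (i \<in> {- int n..int n} \<longrightarrow> u i \<in> {- int m..int m}) \<and>
        (i \<notin> {- int n..int n} \<longrightarrow> u i = 0)}"
    proof (rule subsetI, rule CollectI, rule allI)
      fix u i assume u: "u \<in> labellings n m \<pi>"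
      show "(i \<in> {- int n..int n} \<longrightarrow> u i \<in> {- int m..int m}) \<and> (i \<notin> {- int n..int n} \<longrightarrow> u i = 0)"
        using labellingsD(3)[OF u, of i] labellingsD(4)[OF u, of i] by auto
    qed
  qed (rule finite_set_of_finite_funs, auto)
  have "(\<Sum>\<pi>\<in>signed_involutions n. of_nat (card (labellings n m \<pi>)) * p ^ fix_B n \<pi>) =
      (\<Sum>(\<pi>, u)\<in>?S. p ^ fix_B n \<pi>)"
    by (subst sum.Sigma[symmetric]) (auto simp: fin_perm fin_lab)
  also have "\<dots> = (\<Sum>(\<pi>, u)\<in>?S. \<Prod>c\<in>reps m. p ^ fix_weight c (count (rep_mset m (table n \<pi> u)) c))"
    by (intro sum.cong refl) (auto simp: fix_eq power_sum)
  also have "\<dots> = (\<Sum>A\<in>even_multisets n m. \<Prod>c\<in>reps m. p ^ fix_weight c (count A c))"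
    by (subst sum.reindex_bij_betw[OF bij, symmetric]) (simp add: case_prod_unfold)
  finally show ?thesis .
qed

text \<open>Generating function of the choices for a single orbit, by degree.\<close>

definition rep_series :: "'a::comm_ring_1 \<Rightarrow> int \<times> int \<Rightarrow> 'a fps" where
  "rep_series p c = Abs_fps (\<lambda>d. if fst c = \<bar>snd c\<bar> \<or> even d then p ^ fix_weight c d else 0)"

text \<open>Expanding the product gives a sum over all multisets of size \<open>n\<close>; an odd
  multiplicity off both diagonals contributes a zero factor.\<close>

lemma prod_rep_series_nth:
  fixes p :: "'a::comm_ring_1"
  shows "fps_nth (\<Prod>c\<in>reps m. rep_series p c) n =
           (\<Sum>A\<in>even_multisets n m. \<Prod>c\<in>reps m. p ^ fix_weight c (count A c))"
proof -
  let ?w = "\<lambda>A. \<Prod>c\<in>reps m. fps_nth (rep_series p c) (count A c)"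
  have fin: "finite (multisets_of_size (reps m) n)"
    by (simp add: finite_multisets_of_size)
  have vanish: "?w A = 0" if "A \<in> multisets_of_size (reps m) n - even_multisets n m" for A
  proof -
    obtain c where "c \<in> reps m" "fst c \<noteq> \<bar>snd c\<bar>" "odd (count A c)"
      using \<open>A \<in> _\<close> by (auto simp: even_multisets_def)
    then show ?thesis
      by (intro prod_zero) (auto simp: rep_series_def)
  qed
  have "fps_nth (\<Prod>c\<in>reps m. rep_series p c) n = sum ?w (multisets_of_size (reps m) n)"
    by (simp add: fps_prod_nth')
  also have "\<dots> = sum ?w (even_multisets n m)"
    using fin vanish by (intro sum.mono_neutral_right) (auto simp: even_multisets_def)
  also have "\<dots> = (\<Sum>A\<in>even_multisets n m. \<Prod>c\<in>reps m. p ^ fix_weight c (count A c))"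
    by (intro sum.cong prod.cong refl) (auto simp: rep_series_def even_multisets_def)
  finally show ?thesis .
qed

text \<open>The coefficients are \<open>p ^ d\<close> on the diagonal, \<open>p ^ (d mod 2)\<close>
  on the antidiagonal, and 1 at even degrees elsewhere, so the products with the denominators
  telescope.\<close>

lemma rep_series_mult:
  fixes p :: "'a::comm_ring_1" and x y :: int
  shows "x = y \<Longrightarrow> 0 \<le> x \<Longrightarrow> rep_series p (x, y) * (1 - fps_const p * fps_X) = 1"
    "x = - y \<Longrightarrow> 0 < x \<Longrightarrow> rep_series p (x, y) * (1 - fps_X ^ 2) = 1 + fps_const p * fps_X"
    "0 \<le> x \<Longrightarrow> x < \<bar>y\<bar> \<Longrightarrow> rep_series p (x, y) * (1 - fps_X ^ 2) = 1"
proof -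
  assume *: "x = y" "0 \<le> x"
  have "rep_series p (x, y) * (1 - fps_const p * fps_X) =
      rep_series p (x, y) - fps_const p * (fps_X * rep_series p (x, y))"
    by (simp add: algebra_simps)
  also have "\<dots> = 1"
  proof (rule fps_ext)
    fix d
    show "fps_nth (rep_series p (x, y) - fps_const p * (fps_X * rep_series p (x, y))) d = fps_nth 1 d"
      using * by (cases d) (simp_all add: rep_series_def fix_weight_def)
  qed
  finally show "rep_series p (x, y) * (1 - fps_const p * fps_X) = 1" .
next
  assume *: "x = - y" "0 < x"
  show "rep_series p (x, y) * (1 - fps_X ^ 2) = 1 + fps_const p * fps_X"
  proof (rule fps_ext)
    fix d :: nat
    have "d = 0 \<or> d = 1 \<or> d = (d - 2) + 2"
      by presburger
    then consider "d = 0" | "d = 1" | e where "d = e + 2"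
      by blast
    then show "fps_nth (rep_series p (x, y) * (1 - fps_X ^ 2)) d = fps_nth (1 + fps_const p * fps_X) d"
      using * by cases (auto simp: rep_series_def fix_weight_def right_diff_distrib fps_X_power_mult_right_nth)
  qed
next
  assume *: "0 \<le> x" "x < \<bar>y\<bar>"
  show "rep_series p (x, y) * (1 - fps_X ^ 2) = 1"
  proof (rule fps_ext)
    fix d :: nat
    have "d = 0 \<or> d = 1 \<or> d = (d - 2) + 2"
      by presburger
    then consider "d = 0" | "d = 1" | e where "d = e + 2"
      by blast
    then show "fps_nth (rep_series p (x, y) * (1 - fps_X ^ 2)) d = fps_nth 1 d"
      using * by cases (auto simp: rep_series_def fix_weight_def right_diff_distrib fps_X_power_mult_right_nth)
  qed
qed

section \<open>The product over all representatives\<close>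

lemma prod_mult_power_card:
  fixes f :: "'b \<Rightarrow> 'a::comm_monoid_mult"
  assumes "\<And>x. x \<in> A \<Longrightarrow> f x * q = 1"
  shows "prod f A * q ^ card A = 1"
  using assms by (simp add: prod_constant[symmetric] prod.distrib[symmetric] del: prod_constant)

text \<open>The new layer has one diagonal and one antidiagonal representative and
  \<open>2 * m + 1\<close> others; \<open>x = 0\<close> occurs only with positive
  \<open>y\<close>.\<close>

lemma reps_Suc:
  "reps (Suc m) = reps m \<union> {(int m + 1, int m + 1)} \<union> {(int m + 1, - (int m + 1))} \<union>
     ({0..int m} \<times> {int m + 1} \<union> {1..int m} \<times> {- (int m + 1)})"
proof (rule Set.set_eqI)
  fix c :: "int \<times> int"
  obtain x y :: int where c: "c = (x, y)"
    by (cases c)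
  show "c \<in> reps (Suc m) \<longleftrightarrow> c \<in> reps m \<union> {(int m + 1, int m + 1)} \<union> {(int m + 1, - (int m + 1))} \<union>
     ({0..int m} \<times> {int m + 1} \<union> {1..int m} \<times> {- (int m + 1)})"
    unfolding c
    by (cases "y = int m + 1"; cases "y = - (int m + 1)") (auto simp: reps_def box_def)
qed

lemma prod_rep_series:
  fixes p :: "'a::comm_ring_1"
  shows "(\<Prod>c\<in>reps m. rep_series p c) * ((1 - fps_const p * fps_X) ^ (m + 1) * (1 - fps_X ^ 2) ^ (m * (m + 1))) =
           (1 + fps_const p * fps_X) ^ m"
proof (induction m)
  case 0
  have "reps 0 = {(0, 0)}"
    by (auto simp: reps_def box_def)
  then show ?case
    by (simp add: rep_series_mult)
next
  case (Suc m)
  let ?s = "rep_series p" and ?M = "int m + 1" and ?a = "1 - fps_const p * fps_X" and ?b = "1 - fps_X ^ 2 :: 'a fps"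
  let ?R = "{0..int m} \<times> {?M} \<union> {1..int m} \<times> {- ?M}"
  have "card ?R = 2 * m + 1"
    by (subst card_Un_disjoint) (auto simp: card_cartesian_product)
  moreover have "?s c * ?b = 1" if "c \<in> ?R" for c
    using that rep_series_mult(3)[of "fst c" "snd c" p] by (cases c) auto
  ultimately have R: "prod ?s ?R * ?b ^ (2 * m + 1) = 1"
    using prod_mult_power_card[of ?R ?s ?b] by simp
  have "prod ?s (reps (Suc m)) = prod ?s (reps m) * ?s (?M, ?M) * ?s (?M, - ?M) * prod ?s ?R"
    unfolding reps_Suc
    by (subst prod.union_disjoint, simp, simp, force simp: reps_def box_def)+ simp
  \<comment> \<open>The exponent of \<open>1 - fps_X ^ 2\<close> grows by 1 for the antidiagonal
    orbit and by \<open>2 * m + 1\<close> for the others.\<close>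
  moreover have "Suc m * (Suc m + 1) = m * (m + 1) + 1 + (2 * m + 1)"
    by simp
  ultimately have "prod ?s (reps (Suc m)) * (?a ^ (Suc m + 1) * ?b ^ (Suc m * (Suc m + 1))) =
      (prod ?s (reps m) * (?a ^ (m + 1) * ?b ^ (m * (m + 1)))) * (?s (?M, ?M) * ?a) *
      (?s (?M, - ?M) * ?b) * (prod ?s ?R * ?b ^ (2 * m + 1))"
    by (simp only: power_add power_one_right mult_ac add_Suc power_Suc)
  also have "\<dots> = (1 + fps_const p * fps_X) ^ Suc m"
    using rep_series_mult(1)[of ?M ?M p] rep_series_mult(2)[of ?M "- ?M" p]
    by (simp only: Suc.IH R power_Suc2) simp
  finally show ?case .
qed

text \<open>The exponent \<open>m\<close> of t becomes the box size. By \<open>descent_coeff\<close>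
  and \<open>card_labellings\<close>, an involution contributes \<open>q ^ fix_B n \<pi>\<close>
  once for each of its labellings.\<close>

lemma inv_poly_coeff:
  fixes q :: "'a::comm_ring_1"
  shows "fps_nth (inv_poly n (fps_const q) fps_X * fps_recip ((1 - fps_X) ^ (n + 1))) m =
           fps_nth (\<Prod>c\<in>reps m. rep_series q c) n"
proof -
  let ?D = "\<lambda>\<pi>. {i. \<pi> (int i) > \<pi> (int i + 1)}" and ?r = "fps_recip ((1 - fps_X) ^ (n + 1)) :: 'a fps"
  have des: "des_B n \<pi> = card {i. i < n \<and> i \<in> ?D \<pi>}" for \<pi>
  proof -
    have "{i \<in> {0..<int n}. \<pi> i > \<pi> (i + 1)} = int ` {i. i < n \<and> i \<in> ?D \<pi>}"
      by (auto simp: image_iff) (metis nat_eq_iff2 zless_nat_conj nat_less_iff of_nat_0_le_iff)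
    then show ?thesis
      unfolding des_B_def by (simp add: card_image)
  qed
  have "fps_nth (fps_const q ^ fix_B n \<pi> * fps_X ^ des_B n \<pi> * ?r) m =
      of_nat (card (labellings n m \<pi>)) * q ^ fix_B n \<pi>" if "\<pi> \<in> signed_involutions n" for \<pi>
  proof -
    have "\<pi> \<in> signed_perms n"
      using that by (simp add: signed_involutions_def)
    then have "fps_nth (fps_X ^ des_B n \<pi> * ?r) m = of_nat (card (labellings n m \<pi>))"
      by (simp only: des descent_coeff card_labellings)
    moreover have "fps_const q ^ fix_B n \<pi> * fps_X ^ des_B n \<pi> * ?r =
        fps_const (q ^ fix_B n \<pi>) * (fps_X ^ des_B n \<pi> * ?r)"
      by (simp only: mult.assoc fps_const_power)
    ultimately show ?thesis
      by (simp only: fps_mult_left_const_nth mult.commute)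
  qed
  then have "fps_nth (inv_poly n (fps_const q) fps_X * ?r) m =
      (\<Sum>\<pi>\<in>signed_involutions n. of_nat (card (labellings n m \<pi>)) * q ^ fix_B n \<pi>)"
    by (simp add: inv_poly_def sum_distrib_right fps_sum_nth)
  then show ?thesis
    by (simp only: sum_involutions_multisets prod_rep_series_nth)
qed

theorem theorem1p1:
  "fps2_sums
     (\<lambda>m. t\<^sub>2 ^ m * ((1 + p\<^sub>2 * z\<^sub>2) ^ m *
            fps_recip ((1 - p\<^sub>2 * z\<^sub>2) ^ (m + 1) * (1 - z\<^sub>2 ^ 2) ^ (m * (m + 1)))))
     (Abs_fps (\<lambda>n. inv_poly n p\<^sub>1 t\<^sub>1 * fps_recip ((1 - t\<^sub>1) ^ (n + 1))))"
  unfolding fps2_sums_def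
proof (intro allI)
  fix n j
  let ?p = "[:0, 1:] :: int poly"
  let ?h = "\<lambda>m. (1 + p\<^sub>2 * z\<^sub>2) ^ m * fps_recip ((1 - p\<^sub>2 * z\<^sub>2) ^ (m + 1) * (1 - z\<^sub>2 ^ 2) ^ (m * (m + 1)))"
  let ?S = "Abs_fps (\<lambda>n. inv_poly n p\<^sub>1 t\<^sub>1 * fps_recip ((1 - t\<^sub>1) ^ (n + 1)))"
  have h: "?h m = (\<Prod>c\<in>reps m. rep_series p\<^sub>1 c)" for m
  proof -
    let ?d = "(1 - p\<^sub>2 * z\<^sub>2) ^ (m + 1) * (1 - z\<^sub>2 ^ 2) ^ (m * (m + 1))"
    have "?d * fps_recip ?d = 1"
      by (rule fps_recip_right) (simp add: fps_nth_power_0)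
    then have "(\<Prod>c\<in>reps m. rep_series p\<^sub>1 c) * ?d * fps_recip ?d = (\<Prod>c\<in>reps m. rep_series p\<^sub>1 c)"
      by (simp only: mult.assoc mult_1_right)
    then show ?thesis
      by (simp only: prod_rep_series)
  qed
  \<comment> \<open>The coefficients of the product are free of t, because \<open>p\<^sub>1\<close>
    is a constant series in t.\<close>
  have h_nth: "fps_nth (?h m) n = fps_const (fps_nth (\<Prod>c\<in>reps m. rep_series ?p c) n)" for m
    unfolding h prod_rep_series_nth power_sum[symmetric] unfolding fps_const_power
    by (rule fps_ext) (simp add: fps_sum_nth)
  have "fps_nth (fps_nth (t\<^sub>2 ^ m * ?h m) n) j =
      (if m = j then fps_nth (fps_nth ?S n) j else 0)" for m
  proof -
    have "fps_nth (t\<^sub>2 ^ m * ?h m) n = t\<^sub>1 ^ m * fps_const (fps_nth (\<Prod>c\<in>reps m. rep_series ?p c) n)"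
      by (simp only: fps_const_power fps_mult_left_const_nth h_nth)
    also have "fps_nth \<dots> j = (if m = j then fps_nth (\<Prod>c\<in>reps m. rep_series ?p c) n else 0)"
      by (simp add: fps_X_power_mult_nth)
    also have "\<dots> = (if m = j then fps_nth (fps_nth ?S n) j else 0)"
      by (simp only: fps_nth_Abs_fps inv_poly_coeff) auto
    finally show ?thesis .
  qed
  \<comment> \<open>The power of t singles out the summand \<open>m = j\<close>, so the coefficient
    is final as soon as \<open>N > j\<close>.\<close>
  then have "fps_nth (fps_nth (\<Sum>m<N. t\<^sub>2 ^ m * ?h m) n) j = fps_nth (fps_nth ?S n) j" if "N > j" for N
    using that by (simp only: fps_sum_nth sum.delta) simp
  then show "\<forall>\<^sub>F N in sequentially.
      fps_nth (fps_nth (\<Sum>m<N. t\<^sub>2 ^ m * ?h m) n) j = fps_nth (fps_nth ?S n) j"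
    using eventually_gt_at_top[of j] by (rule eventually_mono[rotated])
qed

end
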